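(* Consider the closed-loop system obtained by applying Algorithm 1 (specified in the context) to $x_{t+1}=A(\theta^\ast)x_t+B(\theta^\ast)u_t+Fw_t$, with $w_t\in\mathcal{W}$ for all $t$. If the optimization problem $\mathcal{P}_{>0}$ is feasible at time $t=1$ and $\Theta_t\subseteq\Theta_{t-1}$ for all $t$, then the online optimization $\mathcal{P}_{>0}$ in Algorithm 1 is feasible at all times $t\ge1$.
   Context: **Model.** $x_t\in\mathbb{R}^{n_x}$, $u_t\in\mathbb{R}^{n_u}$, $w_t\in\mathbb{R}^{n_w}$ satisfy $x_{t+1}=A(\theta^\ast)x_t+B(\theta^\ast)u_t+Fw_t$ for $t\in\mathbb{N}_{\ge0}$, with $w_t\in\mathcal{W}$ (a known bounded convex polyhedral set) and $\theta^\ast\in\mathbb{R}^p$ an unknown constant. For known matrices $A_i,B_i$, $A(\theta)=A_0+\sum_{i=1}^p[\theta]_iA_i$ and $B(\theta)=B_0+\sum_{i=1}^p[\theta]_iB_i$. The polytope $\Theta_0=\{\theta: M_\Theta\theta\le\mu_0\}$ is known and $\theta^\ast\in\Theta_0$. Define $A_K(\theta)=A(\theta)+B(\theta)K$ and $\Phi(x,u)=[A_1x+B_1u\ \cdots\ A_px+B_pu]\in\mathbb{R}^{n_x\times p}$. A polytope is a compact convex polyhedron; $\oplus$ is Minkowski sum; $\mathbb{N}_{[a,b]}=\{a,\ldots,b\}$; $\mathrm{Co}$ is convex hull; $\succeq$ is the semidefinite order; a subscript $k|t$ denotes a $k$-step-ahead prediction made at time $t$. **Offline data.** Polytopes $\mathcal{X},\mathcal{U}$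 (state and input constraint sets) and $\mathcal{S}$; horizons $N$, $N_u$ and a window length $N_\mu$; a gain $K$ such that $z_{t+1}\in\mathrm{Co}\{A_K(\theta)z_t:\theta\in\Theta_0\}$ is quadratically stable (there is $P=P^\top\succ0$ with $P-A_K(\theta)^\top PA_K(\theta)\succ0$ at all vertices $\theta$ of $\Theta_0$); a terminal polytope $\mathcal{X}_T$ with $\mathcal{X}_T\subseteq\mathcal{X}$, $K\mathcal{X}_T\oplus\mathcal{S}\subseteq\mathcal{U}$, and $A_K(\theta)\mathcal{X}_T\oplus B(\theta)\mathcal{S}\oplus F\mathcal{W}\subseteq\mathcal{X}_T$ for all $\theta\in\Theta_0$; a nominal parameter $\bar\theta_0\in\Theta_0$; a number of samples $N_s$. **Noise.** For each $t$, $\mathbf{s}_t=\{s_{k|t}\}_{k\in\mathbb{N}_{[0,N+N_u-1]}}$ is an i.i.d. zero-mean random sequence in $\mathcal{S}$ with $\mathbb{E}(s_{k|t}s_{k|t}^\top)\succeq\epsilon_sI$, $\epsilon_s>0$, independent of $x_t$ and $w_t$; $\mathbf{s}_t$ and $\mathbf{s}_q$ are independent for $t\ne q$. **Parameter estimates.** $\Delta_t=\{\theta: x_t-A(\theta)x_{t-1}-B(\theta)u_{t-1}\in F\mathcal{W}\}$ for $t\ge1$ and $\Delta_t=\mathbb{R}^p$ for $t\le0$. $\Theta_t=\{\theta:M_\Theta\theta\le\mu_t\}$ is the smallest set of this form containing $\Theta_{t-1}\cap\bigcap_{j=t-N_\mu+1}^t\Delta_j$ (so $[\mu_t]_i$ is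 the maximum of $[M_\Theta]_i\theta$ over that intersection), and $\bar\theta_t=\arg\min_{\theta\in\Theta_t}\|\bar\theta_{t-1}-\theta\|$. **Tubes.** $\mathbf{v}_t=\{v_{0|t},\ldots,v_{N-1|t}\}$ and $\mathbf{X}_t=\{\mathcal{X}_{k|t}\}_{k\in\mathbb{N}_{[0,N+N_u-1]}}$ with $\mathcal{X}_{k|t}=\mathrm{Co}\{x^{(1)}_{k|t},\ldots,x^{(\nu)}_{k|t}\}$ belonging to a fixed tube class that contains singletons and $\mathcal{X}_T$: homothetic copies $\{z\}\oplus\alpha\mathcal{X}^0$, $\alpha\ge0$, of a fixed polytope $\mathcal{X}^0$ with vertices $x^{0(j)}$, with $x^{(j)}=z+\alpha x^{0(j)}$; or sets $\{x:Tx\le\alpha\}$ for fixed $T$ with vertices $x^{(j)}$ depending linearly on $\alpha$. Tube constraints, for all $\theta\in\Theta_t$ and $k\in\mathbb{N}_{[0,N-1]}$: $\mathcal{X}_{k|t}\subseteq\mathcal{X}$; $K\mathcal{X}_{k|t}\oplus\{v_{k|t}\}\subseteq\mathcal{U}$; $A_K(\theta)\mathcal{X}_{k|t}\oplus\{B(\theta)v_{k|t}\}\oplus F\mathcal{W}\subseteq\mathcal{X}_{k+1|t}$; together with $\mathcal{X}_{0|t}=\{x_t\}$ and $\mathcal{X}_{k|t}=\mathcal{X}_T$ for $k\in\mathbb{N}_{[N,N+N_u-1]}$. **Cost.** $J(x_t,\mathbf{v}_t,\bar\theta_t)=\sum_{k=0}^{N-1}l(\bar x_{k|t},K\bar x_{k|t}+v_{k|t})+V_{N|t}(\bar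 x_{N|t})$ with $\bar x_{0|t}=x_t$, $\bar x_{k+1|t}=A_K(\bar\theta_t)\bar x_{k|t}+B(\bar\theta_t)v_{k|t}$, where $l$, $V_{N|t}$ are positive definite quadratic functions and $V_{N|t}(x)=V_{N|t}(A_K(\bar\theta_t)x)+l(x,Kx)$ for all $x$. **Reference trajectory** ($t\ge1$), using the time $t-1$ solution $(\mathbf{v}^o_{t-1},\mathbf{X}^o_{t-1})$: $\hat v_{k|t}=v^o_{k+1|t-1}$ for $k\le N-2$, $\hat v_{N-1|t}=s_{N-1|t}$; $\hat x_{0|t}=x_t$, $\hat x_{k+1|t}=A(\bar\theta_t)\hat x_{k|t}+B(\bar\theta_t)\hat u_{k|t}$, $\hat u_{k|t}=K\hat x_{k|t}+\hat v_{k|t}$ for $k<N$ and $\hat u_{k|t}=K\hat x_{k|t}+s_{k|t}$ for $k\ge N$; $\hat\Phi_{k|t}=\Phi(\hat x_{k|t},\hat u_{k|t})$. **Linearized PE constraints** ($t\ge1$). $N_{pe}=N+t$ if $t<N_u-1$ and $N_{pe}=N+N_u-1$ if $t\ge N_u-1$. For $\kappa\in\mathbb{N}_{[N-N_{pe},N-1]}$: $$\sum_{k=\kappa}^{-1}\Phi_{k+t}^\top\Phi_{k+t}+\sum_{k=\max\{0,\kappa\}}^{\kappa+N_u-1}M_{k|t}\succeq\beta'_{\kappa|t}I,\qquad(\mathrm{PE})$$ where $\Phi_{k+t}=\Phi(x_{k+t},u_{k+t})$, the first sum is empty if $\kappa\ge0$, and the symmetric $p\times p$ variables $M_{k|t}$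 satisfy, for all $j\in\mathbb{N}_{[1,\nu]}$, $M_{k|t}\preceq\hat\Phi_{k|t}^\top\hat\Phi_{k|t}+\hat\Phi_{k|t}^\top D+D^\top\hat\Phi_{k|t}$ with $D=\Phi(x^{(j)}_{k|t}-\hat x_{k|t},\,Kx^{(j)}_{k|t}+q_{k|t}-\hat u_{k|t})$, $q_{k|t}=v_{k|t}$ if $k<N$ and $q_{k|t}=s_{k|t}$ if $k\ge N$. Further, $$\beta'_{\kappa|t}\ge\hat\beta'_{\kappa|t},\quad\kappa\in\mathbb{N}_{[N-N_{pe},N-1]},\qquad(\mathrm{B})$$ where $\hat\beta'_{\kappa|t}$ is the maximum $\beta'_{\kappa|t}$ for which (PE) holds (for some $M_{k|t}$) with $q_{k|t}=\hat v_{k|t}$ for $k<N$, $q_{k|t}=s_{k|t}$ for $k\ge N$, $x^{(j)}_{0|t}=x_t$, and $x^{(j)}_{k|t}=x^{(j)\,o}_{k+1|t-1}$ (vertices of $\mathbf{X}^o_{t-1}$) for $k>0$. **Sampled PE coefficients.** For each predicted $k\ge0$ draw $N_s$ independent samples uniformly distributed on the optimized set $\mathcal{X}_{k|t}$, and $N_s$ on $\mathcal{X}^o_{k+1|t-1}$ (replaced by $\{x_t\}$ if $k=0$). $\beta^s_{\kappa|t}$ (resp. $\hat\beta^s_{\kappa|t}$) is the largest $\beta$ such that $\sum_{k=\kappa}^{\kappa+N_u-1}\Phi(y_k,Ky_k+q_{k|t})^\top\Phi(y_k,Ky_k+q_{k|t})\succeq\beta I$ for all selections of $y_k$ among the samples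 of the first (resp. second) kind, with $q_{k|t}=v^o_{k|t}$ (resp. $\hat v_{k|t}$) for $k<N$, $q_{k|t}=s_{k|t}$ for $k\ge N$, and with the realized term $\Phi_{k+t}^\top\Phi_{k+t}$ for $k<0$. **Algorithm 1.** At $t=0$: compute the solution $(\mathbf{v}^o_0,\mathbf{X}^o_0)$ of $\mathcal{P}_0$ (assumed feasible): minimize $J(x_0,\mathbf{v}_0,\bar\theta_0)$ subject to the tube constraints; apply $u_0=Kx_0+v^o_{0|0}$. At $t=1,2,\ldots$: (a) obtain $x_t$; (b) update $\Theta_t,\bar\theta_t,V_{N|t}$; (c) generate $\mathbf{s}_t$ and compute the reference quantities and $\hat\beta'_{\kappa|t}$; (d) compute the solution $(\mathbf{v}^o_t,\mathbf{X}^o_t)$ of $\mathcal{P}_{>0}$: minimize $J(x_t,\mathbf{v}_t,\bar\theta_t)$ over $\mathbf{v}_t,\mathbf{X}_t$, $\{\beta'_{\kappa|t}\}$, $\{M_{k|t}\}$ subject to the tube constraints, (PE) and (B); (e) compute $\beta^s_{\kappa|t},\hat\beta^s_{\kappa|t}$ and, if $\beta^s_{\kappa|t}<\hat\beta^s_{\kappa|t}$ for any $\kappa\in\mathbb{N}_{[N-N_{pe},N-1]}$, set $\mathbf{v}^o_t:=\hat{\mathbf{v}}_t$ and $\mathbf{X}^o_t:=\{\{x_t\},\mathcal{X}^o_{2|t-1},\ldots,\mathcal{X}^o_{N-1|t-1},\mathcal{X}_T,\ldots,\mathcal{X}_T\}$; (f) apply $u_t=Kx_t+v^o_{0|t}$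.
   Formalization: The bounds β̂'_κ are taken as a jointly maximal family: (PE) holds for all κ with one common choice of the M_k, and no single β̂'_κ can be increased. With a separate maximum (separate M_k) for each κ the claim fails, as these maxima need not be attained by common M_k. *)

theory Defs
  imports "HOL-Probability.Probability"
begin

definition psd :: "real^'n^'n \<Rightarrow> bool" where
  "psd A \<longleftrightarrow> transpose A = A \<and> (\<forall>v. 0 \<le> v \<bullet> (A *v v))"

definition pd :: "real^'n^'n \<Rightarrow> bool" where
  "pd A \<longleftrightarrow> transpose A = A \<and> (\<forall>v. v \<noteq> 0 \<longrightarrow> 0 < v \<bullet> (A *v v))"

definition loewner_le :: "real^'n^'n \<Rightarrow> real^'n^'n \<Rightarrow> bool" (infix "\<preceq>" 50) where
  "A \<preceq> B \<longleftrightarrow> psd (B - A)"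

definition gram :: "real^'n^'m \<Rightarrow> real^'n^'n" where
  "gram A = transpose A ** A"

definition pos_def_quadratic :: "('a::real_vector \<Rightarrow> real) \<Rightarrow> bool" where
  "pos_def_quadratic f \<longleftrightarrow>
     (\<exists>b. bilinear b \<and> (\<forall>x y. b x y = b y x) \<and> (\<forall>x. f x = b x x)) \<and> (\<forall>x. x \<noteq> 0 \<longrightarrow> 0 < f x)"

definition is_maximum :: "real set \<Rightarrow> real \<Rightarrow> bool" where
  "is_maximum S m \<longleftrightarrow> m \<in> S \<and> (\<forall>b\<in>S. b \<le> m)"


text \<open>A tube cross section is represented by its family of vertices \<open>x\<^sup>(\<^sup>j\<^sup>)\<close>, with \<open>j\<close> ranging over
  the finite type \<open>'v\<close> (so \<open>\<nu>\<close> is the cardinality of \<open>'v\<close>; vertices may coincide, e.g. for a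
  singleton). \<open>Polyhedral T L\<close> is the class of sets \<open>{y. T y \<le> \<alpha>}\<close> whose vertices are \<open>L j \<alpha>\<close>.\<close>

datatype ('nx::finite, 'v::finite, 'r::finite) tube_spec =
    Homothetic "'v \<Rightarrow> real^'nx"
  | Polyhedral "real^'nx^'r" "'v \<Rightarrow> real^'r^'nx"

definition tube_set :: "('v::finite \<Rightarrow> real^'nx) \<Rightarrow> (real^'nx) set" where
  "tube_set f = convex hull (range f)"

fun wf_tube_spec :: "('nx::finite, 'v::finite, 'r::finite) tube_spec \<Rightarrow> bool" where
  "wf_tube_spec (Homothetic x0) \<longleftrightarrow> inj x0 \<and> (\<forall>j. x0 j extreme_point_of tube_set x0)"
| "wf_tube_spec (Polyhedral T L) \<longleftrightarrow> True"

fun tube_class :: "('nx::finite, 'v::finite, 'r::finite) tube_spec \<Rightarrow> ('v \<Rightarrow> real^'nx) set" where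
  "tube_class (Homothetic x0) = {\<lambda>j. z + \<alpha> *\<^sub>R x0 j | z \<alpha>. 0 \<le> \<alpha>}"
| "tube_class (Polyhedral T L) =
     {\<lambda>j. L j *v \<alpha> | \<alpha>. {y. T *v y \<le> \<alpha>} = tube_set (\<lambda>j. L j *v \<alpha>) \<and>
                         (\<forall>j. (L j *v \<alpha>) extreme_point_of {y. T *v y \<le> \<alpha>})}"


record ('nx::finite, 'nu::finite, 'nw::finite, 'p::finite, 'm::finite, 'v::finite, 'r::finite)
    mpc_data =
  mat_A0 :: "real^'nx^'nx"
  mat_A :: "'p \<Rightarrow> real^'nx^'nx"
  mat_B0 :: "real^'nu^'nx"
  mat_B :: "'p \<Rightarrow> real^'nu^'nx"
  mat_F :: "real^'nw^'nx"
  set_W :: "(real^'nw) set"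
  mat_MTheta :: "real^'p^'m"
  mu_init :: "real^'m"
  theta_init :: "real^'p"
  set_X :: "(real^'nx) set"
  set_U :: "(real^'nu) set"
  set_S :: "(real^'nu) set"
  set_XT :: "(real^'nx) set"
  gain :: "real^'nx^'nu"
  hor_N :: nat
  hor_Nu :: nat
  win_Nmu :: nat
  num_Ns :: nat
  tubes :: "('nx, 'v, 'r) tube_spec"
  stage_cost :: "(real^'nx) \<times> (real^'nu) \<Rightarrow> real"

definition A_of where
  "A_of D \<theta> = mat_A0 D + (\<Sum>i\<in>UNIV. (\<theta> $ i) *\<^sub>R mat_A D i)"

definition B_of where
  "B_of D \<theta> = mat_B0 D + (\<Sum>i\<in>UNIV. (\<theta> $ i) *\<^sub>R mat_B D i)"

definition AK_of where
  "AK_of D \<theta> = A_of D \<theta> + B_of D \<theta> ** gain D"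

definition Phi ::
  "('nx::finite,'nu::finite,'nw::finite,'p::finite,'m::finite,'v::finite,'r::finite) mpc_data
     \<Rightarrow> real^'nx \<Rightarrow> real^'nu \<Rightarrow> real^'p^'nx" where
  "Phi D x u = (\<chi> r i. (mat_A D i *v x + mat_B D i *v u) $ r)"

definition FW where
  "FW D = (\<lambda>w. mat_F D *v w) ` set_W D"

definition Theta_of where
  "Theta_of D \<mu> = {\<theta>. mat_MTheta D *v \<theta> \<le> \<mu>}"

text \<open>The set sums below are Minkowski sums.\<close>

definition offline_data ::
  "('nx::finite,'nu::finite,'nw::finite,'p::finite,'m::finite,'v::finite,'r::finite) mpc_data
     \<Rightarrow> bool" where
  "offline_data D \<longleftrightarrow>
     1 \<le> hor_N D \<and> 1 \<le> hor_Nu D \<and> 1 \<le> win_Nmu D \<and> 1 \<le> num_Ns D \<and>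
     polyhedron (set_W D) \<and> bounded (set_W D) \<and>
     polytope (Theta_of D (mu_init D)) \<and> theta_init D \<in> Theta_of D (mu_init D) \<and>
     polytope (set_X D) \<and> polytope (set_U D) \<and> polytope (set_S D) \<and> polytope (set_XT D) \<and>
     (\<exists>P. pd P \<and> (\<forall>\<theta>. \<theta> extreme_point_of Theta_of D (mu_init D) \<longrightarrow>
              pd (P - transpose (AK_of D \<theta>) ** P ** AK_of D \<theta>))) \<and>
     set_XT D \<subseteq> set_X D \<and>
     (\<lambda>x. gain D *v x) ` set_XT D + set_S D \<subseteq> set_U D \<and>
     (\<forall>\<theta>\<in>Theta_of D (mu_init D).
        (\<lambda>x. AK_of D \<theta> *v x) ` set_XT D + (\<lambda>v. B_of D \<theta> *v v) ` set_S D + FW D \<subseteq> set_XT D) \<and>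
     wf_tube_spec (tubes D) \<and>
     (\<forall>z. (\<lambda>_. z) \<in> tube_class (tubes D)) \<and>
     (\<exists>f\<in>tube_class (tubes D). tube_set f = set_XT D) \<and>
     pos_def_quadratic (stage_cost D)"


definition tube_constraints where
  "tube_constraints D \<Theta> x v X \<longleftrightarrow>
     (\<forall>k < hor_N D + hor_Nu D. X k \<in> tube_class (tubes D)) \<and>
     (\<forall>\<theta>\<in>\<Theta>. \<forall>k < hor_N D.
        tube_set (X k) \<subseteq> set_X D \<and>
        (\<lambda>y. gain D *v y) ` tube_set (X k) + {v k} \<subseteq> set_U D \<and>
        (\<lambda>y. AK_of D \<theta> *v y) ` tube_set (X k) + {B_of D \<theta> *v v k} + FW D \<subseteq> tube_set (X (k + 1))) \<and>
     tube_set (X 0) = {x} \<and>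
     (\<forall>k\<in>{hor_N D..hor_N D + hor_Nu D - 1}. tube_set (X k) = set_XT D)"

primrec nominal_state where
  "nominal_state D \<theta> x v 0 = x"
| "nominal_state D \<theta> x v (Suc k) =
     AK_of D \<theta> *v nominal_state D \<theta> x v k + B_of D \<theta> *v v k"

definition cost where
  "cost D V x v \<theta> =
     (\<Sum>k<hor_N D. stage_cost D (nominal_state D \<theta> x v k, gain D *v nominal_state D \<theta> x v k + v k))
     + V (nominal_state D \<theta> x v (hor_N D))"

definition terminal_cost_ok where
  "terminal_cost_ok D \<theta> V \<longleftrightarrow> pos_def_quadratic V \<and>
     (\<forall>x. V x = V (AK_of D \<theta> *v x) + stage_cost D (x, gain D *v x))"

text \<open>The perturbation entering the input at prediction step \<open>k\<close>: \<open>v\<^sub>k\<close> for \<open>k < N\<close>, \<open>s\<^sub>k\<close> afterwards.\<close>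

definition pert where
  "pert D v s k = (if k < hor_N D then v k else s k)"

definition ref_v where
  "ref_v D vprev s k = (if k < hor_N D - 1 then vprev (k + 1) else s (hor_N D - 1))"

primrec ref_x where
  "ref_x D \<theta> x q 0 = x"
| "ref_x D \<theta> x q (Suc k) =
     A_of D \<theta> *v ref_x D \<theta> x q k + B_of D \<theta> *v (gain D *v ref_x D \<theta> x q k + q k)"

definition ref_u where
  "ref_u D \<theta> x q k = gain D *v ref_x D \<theta> x q k + q k"

text \<open>\<open>N\<^sub>p\<^sub>e\<close> and the range of the window index \<open>\<kappa>\<close>, an integer since windows may start in the past.\<close>

definition N_pe where
  "N_pe D t = (if t + 1 < hor_Nu D then hor_N D + t else hor_N D + hor_Nu D - 1)"

definition windows :: "('nx::finite,'nu::finite,'nw::finite,'p::finite,'m::finite,'v::finite,'r::finite)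
    mpc_data \<Rightarrow> nat \<Rightarrow> int set" where
  "windows D t = {int (hor_N D) - int (N_pe D t)..int (hor_N D) - 1}"

text \<open>The family of linearized PE constraints at time \<open>t\<close>. The matrices \<open>M k\<close> are shared by all
  windows \<open>\<kappa>\<close>; \<open>past k\<close>, for \<open>k < 0\<close>, is the realized term at time \<open>t + k\<close>, \<open>(xh, uh)\<close> is the
  reference trajectory. Only the steps \<open>k \<le> N + N\<^sub>u - 2\<close> occur in some window.\<close>

definition pe_constraints ::
  "('nx::finite,'nu::finite,'nw::finite,'p::finite,'m::finite,'v::finite,'r::finite) mpc_data
     \<Rightarrow> nat \<Rightarrow> (int \<Rightarrow> real^'p^'p) \<Rightarrow> (nat \<Rightarrow> real^'nx) \<Rightarrow> (nat \<Rightarrow> real^'nu)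
     \<Rightarrow> (nat \<Rightarrow> real^'nu) \<Rightarrow> (nat \<Rightarrow> 'v \<Rightarrow> real^'nx) \<Rightarrow> (int \<Rightarrow> real) \<Rightarrow> (nat \<Rightarrow> real^'p^'p) \<Rightarrow> bool" where
  "pe_constraints D t past xh uh q X \<beta> M \<longleftrightarrow>
     (\<forall>k. k + 1 < hor_N D + hor_Nu D \<longrightarrow> transpose (M k) = M k \<and>
        (\<forall>j. let \<Phi> = Phi D (xh k) (uh k);
                 \<Delta> = Phi D (X k j - xh k) (gain D *v X k j + q k - uh k)
             in M k \<preceq> gram \<Phi> + transpose \<Phi> ** \<Delta> + transpose \<Delta> ** \<Phi>)) \<and>
     (\<forall>\<kappa>\<in>windows D t.
        \<beta> \<kappa> *\<^sub>R mat 1 \<preceq>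
          (\<Sum>k\<in>{\<kappa>..-1}. past k) + (\<Sum>k\<in>{max 0 \<kappa>..\<kappa> + int (hor_Nu D) - 1}. M (nat k)))"

text \<open>\<open>\<beta>\<close> is a family of maximal coefficients: the PE constraints hold with a common choice of the matrices
  \<open>M k\<close>, and no \<open>\<beta> \<kappa>\<close> can be increased. (Maximizing each \<open>\<beta> \<kappa>\<close> with a separate choice of the
  \<open>M k\<close> is not what is meant: these maxima need not be attained simultaneously.)\<close>

definition max_pe_coeffs where
  "max_pe_coeffs D t past xh uh q X \<beta> \<longleftrightarrow>
     (\<exists>M. pe_constraints D t past xh uh q X \<beta> M) \<and>
     (\<forall>\<kappa>\<in>windows D t. is_maximum {b. \<exists>M. pe_constraints D t past xh uh q X (\<beta>(\<kappa> := b)) M} (\<beta> \<kappa>))"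

lemma pe_constraints_antimono:
  assumes "pe_constraints D t past xh uh q X \<beta> M" and "\<And>\<kappa>. \<kappa> \<in> windows D t \<Longrightarrow> \<beta>' \<kappa> \<le> \<beta> \<kappa>"
  shows "pe_constraints D t past xh uh q X \<beta>' M"
proof -
  have le: "b' *\<^sub>R mat 1 \<preceq> S" if "b *\<^sub>R mat 1 \<preceq> S" "b' \<le> b" for b b' :: real and S :: "real^'n^'n"
  proof -
    have tr: "transpose (S - c *\<^sub>R mat 1) = S - c *\<^sub>R mat 1 \<longleftrightarrow> transpose S = S" for c :: real
      by (simp add: transpose_def vec_eq_iff mat_def) metis
    have q: "v \<bullet> ((S - c *\<^sub>R mat 1) *v v) = v \<bullet> (S *v v) - c * (v \<bullet> v)" for c :: real and v
      by (simp add: matrix_vector_mult_diff_rdistrib inner_diff_right scaleR_matrix_vector_assoc[symmetric])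
    have "b' * (v \<bullet> v) \<le> b * (v \<bullet> v)" for v :: "real^'n"
      using that(2) by (intro mult_right_mono) auto
    then show ?thesis
      using that(1) unfolding loewner_le_def psd_def tr q by (smt (verit))
  qed
  show ?thesis
    using assms unfolding pe_constraints_def by (blast intro: le)
qed

text \<open>If the separate maxima over the individual windows are attained by a common choice of the
  matrices, then they are the only family of maximal coefficients.\<close>

lemma max_pe_coeffs_iff_separate_maxima:
  assumes "pe_constraints D t past xh uh q X \<beta>m M"
    and sep: "\<And>\<kappa>. \<kappa> \<in> windows D t \<Longrightarrow>
               is_maximum {b. \<exists>\<beta> M. pe_constraints D t past xh uh q X (\<beta>(\<kappa> := b)) M} (\<beta>m \<kappa>)"
  shows "max_pe_coeffs D t past xh uh q X \<beta> \<longleftrightarrow> (\<forall>\<kappa>\<in>windows D t. \<beta> \<kappa> = \<beta>m \<kappa>)"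
proof
  assume L: "max_pe_coeffs D t past xh uh q X \<beta>"
  then obtain M' where M': "pe_constraints D t past xh uh q X \<beta> M'"
    unfolding max_pe_coeffs_def by blast
  have le: "\<beta> \<kappa> \<le> \<beta>m \<kappa>" if "\<kappa> \<in> windows D t" for \<kappa>
    using sep[OF that] M' unfolding is_maximum_def by (metis (mono_tags, lifting) fun_upd_triv mem_Collect_eq)
  have "\<beta>m \<kappa> \<le> \<beta> \<kappa>" if "\<kappa> \<in> windows D t" for \<kappa>
  proof -
    have "pe_constraints D t past xh uh q X (\<beta>(\<kappa> := \<beta>m \<kappa>)) M"
      by (rule pe_constraints_antimono[OF assms(1)]) (auto simp: le)
    then show ?thesis
      using L that unfolding max_pe_coeffs_def is_maximum_def by blast
  qed
  with le show "\<forall>\<kappa>\<in>windows D t. \<beta> \<kappa> = \<beta>m \<kappa>" by force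
next
  assume eq: "\<forall>\<kappa>\<in>windows D t. \<beta> \<kappa> = \<beta>m \<kappa>"
  have "pe_constraints D t past xh uh q X \<beta> M"
    by (rule pe_constraints_antimono[OF assms(1)]) (use eq in auto)
  then show "max_pe_coeffs D t past xh uh q X \<beta>"
    using sep eq unfolding max_pe_coeffs_def is_maximum_def
    by (auto simp: fun_upd_idem)
qed

text \<open>\<open>Y k\<close> is the set of samples drawn for step \<open>k\<close>.\<close>

definition sampled_pe_coeff where
  "sampled_pe_coeff D past q Y \<kappa> =
     (GREATEST \<beta>. \<forall>y. (\<forall>k\<in>{max 0 \<kappa>..\<kappa> + int (hor_Nu D) - 1}. y (nat k) \<in> Y (nat k)) \<longrightarrow>
        \<beta> *\<^sub>R mat 1 \<preceq>
          (\<Sum>k\<in>{\<kappa>..\<kappa> + int (hor_Nu D) - 1}.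
             if k < 0 then past k
             else gram (Phi D (y (nat k)) (gain D *v y (nat k) + q (nat k)))))"


text \<open>One realization of the closed loop. The first argument of every component is the time \<open>t\<close>, the
  second one of \<open>noise\<close>, \<open>v_opt\<close>, \<open>X_opt\<close>, \<open>v_sol\<close>, \<open>X_sol\<close>, \<open>smp\<close>, \<open>smp_ref\<close> is the
  prediction step \<open>k\<close>. \<open>(v_opt, X_opt)\<close> is the minimizer of the optimization problem and
  \<open>(v_sol, X_sol)\<close> the pair \<open>(v\<^sup>o, X\<^sup>o)\<close> that is kept after the sampling test.\<close>

record ('nx::finite, 'nu::finite, 'nw::finite, 'p::finite, 'm::finite, 'v::finite) mpc_run =
  state :: "nat \<Rightarrow> real^'nx"
  input :: "nat \<Rightarrow> real^'nu"
  dist_w :: "nat \<Rightarrow> real^'nw"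
  noise :: "nat \<Rightarrow> nat \<Rightarrow> real^'nu"
  mu :: "nat \<Rightarrow> real^'m"
  theta_bar :: "nat \<Rightarrow> real^'p"
  V_N :: "nat \<Rightarrow> real^'nx \<Rightarrow> real"
  beta_hat :: "nat \<Rightarrow> int \<Rightarrow> real"
  v_opt :: "nat \<Rightarrow> nat \<Rightarrow> real^'nu"
  X_opt :: "nat \<Rightarrow> nat \<Rightarrow> 'v \<Rightarrow> real^'nx"
  v_sol :: "nat \<Rightarrow> nat \<Rightarrow> real^'nu"
  X_sol :: "nat \<Rightarrow> nat \<Rightarrow> 'v \<Rightarrow> real^'nx"
  smp :: "nat \<Rightarrow> nat \<Rightarrow> nat \<Rightarrow> real^'nx"
  smp_ref :: "nat \<Rightarrow> nat \<Rightarrow> nat \<Rightarrow> real^'nx"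

definition Theta_at where
  "Theta_at D R t = Theta_of D (mu R t)"

definition Delta :: "('nx::finite,'nu::finite,'nw::finite,'p::finite,'m::finite,'v::finite,'r::finite)
    mpc_data \<Rightarrow> ('nx,'nu,'nw,'p,'m,'v) mpc_run \<Rightarrow> int \<Rightarrow> (real^'p) set" where
  "Delta D R j =
     (if j \<le> 0 then UNIV
      else {\<theta>. state R (nat j) - A_of D \<theta> *v state R (nat j - 1) - B_of D \<theta> *v input R (nat j - 1)
              \<in> FW D})"

definition parameter_update where
  "parameter_update D R t \<longleftrightarrow>
     (let I = Theta_at D R (t - 1) \<inter> (\<Inter>j\<in>{int t - int (win_Nmu D) + 1..int t}. Delta D R j)
      in \<forall>i. is_maximum ((\<lambda>\<theta>. (mat_MTheta D *v \<theta>) $ i) ` I) (mu R t $ i)) \<and>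
     is_arg_min (\<lambda>\<theta>. norm (theta_bar R (t - 1) - \<theta>)) (\<lambda>\<theta>. \<theta> \<in> Theta_at D R t) (theta_bar R t)"

definition past_term where
  "past_term D R t k = gram (Phi D (state R (nat (k + int t))) (input R (nat (k + int t))))"

definition v_hat where
  "v_hat D R t = ref_v D (v_sol R (t - 1)) (noise R t)"

definition x_hat where
  "x_hat D R t = ref_x D (theta_bar R t) (state R t) (pert D (v_hat D R t) (noise R t))"

definition u_hat where
  "u_hat D R t = ref_u D (theta_bar R t) (state R t) (pert D (v_hat D R t) (noise R t))"

definition X_shift where
  "X_shift R t k = (if k = 0 then (\<lambda>_. state R t) else X_sol R (t - 1) (k + 1))"

definition reference_update where
  "reference_update D R t \<longleftrightarrow>
     max_pe_coeffs D t (past_term D R t) (x_hat D R t) (u_hat D R t)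
       (pert D (v_hat D R t) (noise R t)) (X_shift R t) (beta_hat R t)"

definition P_pos_constraints where
  "P_pos_constraints D R t v X \<beta> M \<longleftrightarrow>
     tube_constraints D (Theta_at D R t) (state R t) v X \<and>
     pe_constraints D t (past_term D R t) (x_hat D R t) (u_hat D R t) (pert D v (noise R t)) X \<beta> M \<and>
     (\<forall>\<kappa>\<in>windows D t. beta_hat R t \<kappa> \<le> \<beta> \<kappa>)"

definition P_pos_feasible where
  "P_pos_feasible D R t \<longleftrightarrow> (\<exists>v X \<beta> M. P_pos_constraints D R t v X \<beta> M)"

definition P_pos_solution where
  "P_pos_solution D R t v X \<longleftrightarrow>
     (\<exists>\<beta> M. is_arg_min (\<lambda>(v, X, \<beta>, M). cost D (V_N R t) (state R t) v (theta_bar R t))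
               (\<lambda>(v, X, \<beta>, M). P_pos_constraints D R t v X \<beta> M) (v, X, \<beta>, M))"

definition P_zero_solution where
  "P_zero_solution D R v X \<longleftrightarrow>
     is_arg_min (\<lambda>(v, X). cost D (V_N R 0) (state R 0) v (theta_bar R 0))
       (\<lambda>(v, X). tube_constraints D (Theta_at D R 0) (state R 0) v X) (v, X)"

definition beta_s where
  "beta_s D R t = sampled_pe_coeff D (past_term D R t) (pert D (v_opt R t) (noise R t))
     (\<lambda>k. smp R t k ` {..<num_Ns D})"

definition beta_s_hat where
  "beta_s_hat D R t = sampled_pe_coeff D (past_term D R t) (pert D (v_hat D R t) (noise R t))
     (\<lambda>k. smp_ref R t k ` {..<num_Ns D})"

definition fallback where
  "fallback D R t \<longleftrightarrow>
     (\<forall>k < hor_N D. v_sol R t k = v_hat D R t k) \<and>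
     (\<forall>k < hor_N D + hor_Nu D. X_sol R t k \<in> tube_class (tubes D) \<and>
        tube_set (X_sol R t k) =
          (if k = 0 then {state R t}
           else if k + 2 \<le> hor_N D then tube_set (X_sol R (t - 1) (k + 1))
           else set_XT D))"

definition select_solution where
  "select_solution D R t \<longleftrightarrow>
     (if \<exists>\<kappa>\<in>windows D t. beta_s D R t \<kappa> < beta_s_hat D R t \<kappa> then fallback D R t
      else v_sol R t = v_opt R t \<and> X_sol R t = X_opt R t)"

text \<open>\<open>R\<close> is generated by the plant with parameter \<open>\<theta>s\<close> and the algorithm. Solving the optimization
  problem, and what depends on its solution, is only required at times at which the problem is
  feasible: otherwise feasibility at all times would be part of the definition.\<close>

definition closed_loop where
  "closed_loop D \<theta>s R \<longleftrightarrow>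
     (\<forall>t. state R (t + 1) = A_of D \<theta>s *v state R t + B_of D \<theta>s *v input R t + mat_F D *v dist_w R t) \<and>
     (\<forall>t. dist_w R t \<in> set_W D) \<and>
     (\<forall>t. \<forall>k < hor_N D + hor_Nu D. noise R t k \<in> set_S D) \<and>
     mu R 0 = mu_init D \<and> theta_bar R 0 = theta_init D \<and>
     (\<forall>t. terminal_cost_ok D (theta_bar R t) (V_N R t)) \<and>
     P_zero_solution D R (v_sol R 0) (X_sol R 0) \<and>
     input R 0 = gain D *v state R 0 + v_sol R 0 0 \<and>
     (\<forall>t\<ge>1. parameter_update D R t \<and> reference_update D R t \<and>
        (P_pos_feasible D R t \<longrightarrow>
           P_pos_solution D R t (v_opt R t) (X_opt R t) \<and>
           select_solution D R t \<and>
           input R t = gain D *v state R t + v_sol R t 0))"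


text \<open>Independence of two random variables; \<open>prob_space.indep_var\<close> would force both value types to
  be equal.\<close>

definition independent_rvs where
  "independent_rvs \<Omega> S X T Y \<longleftrightarrow> X \<in> measurable \<Omega> S \<and> Y \<in> measurable \<Omega> T \<and>
     prob_space.indep_set \<Omega> {X -` A \<inter> space \<Omega> | A. A \<in> sets S} {Y -` B \<inter> space \<Omega> | B. B \<in> sets T}"

definition noise_sequence where
  "noise_sequence D R t = (\<lambda>\<omega>. \<lambda>k\<in>{..<hor_N D + hor_Nu D}. noise (R \<omega>) t k)"

definition noise_model where
  "noise_model D \<Omega> R \<longleftrightarrow> prob_space \<Omega> \<and>
     (\<forall>t. prob_space.indep_vars \<Omega> (\<lambda>_. borel) (\<lambda>k \<omega>. noise (R \<omega>) t k) {..<hor_N D + hor_Nu D} \<and>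
        (\<forall>k < hor_N D + hor_Nu D. \<forall>k' < hor_N D + hor_Nu D.
           distr \<Omega> borel (\<lambda>\<omega>. noise (R \<omega>) t k) = distr \<Omega> borel (\<lambda>\<omega>. noise (R \<omega>) t k')) \<and>
        (\<forall>k < hor_N D + hor_Nu D. integrable \<Omega> (\<lambda>\<omega>. noise (R \<omega>) t k) \<and>
           (\<integral>\<omega>. noise (R \<omega>) t k \<partial>\<Omega>) = 0)) \<and>
     (\<exists>\<epsilon>>0. \<forall>t. \<forall>k < hor_N D + hor_Nu D.
        \<epsilon> *\<^sub>R mat 1 \<preceq> (\<chi> i j. \<integral>\<omega>. noise (R \<omega>) t k $ i * noise (R \<omega>) t k $ j \<partial>\<Omega>)) \<and>
     (\<forall>t. independent_rvs \<Omega>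
            (\<Pi>\<^sub>M k\<in>{..<hor_N D + hor_Nu D}. borel) (noise_sequence D R t)
            borel (\<lambda>\<omega>. (state (R \<omega>) t, dist_w (R \<omega>) t))) \<and>
     (\<forall>t q. t \<noteq> q \<longrightarrow> independent_rvs \<Omega>
            (\<Pi>\<^sub>M k\<in>{..<hor_N D + hor_Nu D}. borel) (noise_sequence D R t)
            (\<Pi>\<^sub>M k\<in>{..<hor_N D + hor_Nu D}. borel) (noise_sequence D R q))"

text \<open>Uniform distribution on a nonempty polytope \<open>P\<close> of any dimension: the uniform distribution on
  \<open>P\<close> thickened by the unit ball of the orthogonal complement of its direction space, projected
  back onto the affine hull. It is a point mass if \<open>P\<close> is a singleton and normalized Lebesgue
  measure if \<open>P\<close> has interior points.\<close>

definition uniform_on :: "'a::euclidean_space set \<Rightarrow> 'a measure" where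
  "uniform_on P =
     distr (uniform_measure lborel (P + {n. norm n \<le> 1 \<and> (\<forall>a\<in>P. \<forall>b\<in>P. orthogonal n (a - b))}))
       borel (closest_point (affine hull P))"

text \<open>\<open>y 0, \<dots>, y (n - 1)\<close> are independent and uniformly distributed on the random polytope with
  vertices \<open>f\<close>, conditionally on \<open>f\<close>.\<close>

definition uniform_samples ::
  "'w measure \<Rightarrow> ('w \<Rightarrow> 'v::finite \<Rightarrow> real^'nx) \<Rightarrow> (nat \<Rightarrow> 'w \<Rightarrow> real^'nx) \<Rightarrow> nat \<Rightarrow> bool" where
  "uniform_samples \<Omega> f y n \<longleftrightarrow>
     f \<in> borel_measurable \<Omega> \<and> (\<forall>i<n. y i \<in> borel_measurable \<Omega>) \<and>
     (\<forall>E. (\<forall>i<n. E i \<in> sets borel) \<longrightarrow>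
        (AE \<omega> in \<Omega>.
           real_cond_exp \<Omega> (vimage_algebra (space \<Omega>) f borel)
             (indicator {\<omega> \<in> space \<Omega>. \<forall>i<n. y i \<omega> \<in> E i}) \<omega>
           = (\<Prod>i<n. measure (uniform_on (tube_set (f \<omega>))) (E i))))"

definition sampling_model where
  "sampling_model D \<Omega> R \<longleftrightarrow>
     (\<forall>t\<ge>1. \<forall>k. k + 1 < hor_N D + hor_Nu D \<longrightarrow>
        uniform_samples \<Omega> (\<lambda>\<omega>. X_opt (R \<omega>) t k) (\<lambda>i \<omega>. smp (R \<omega>) t k i) (num_Ns D) \<and>
        uniform_samples \<Omega> (\<lambda>\<omega>. X_shift (R \<omega>) t k) (\<lambda>i \<omega>. smp_ref (R \<omega>) t k i) (num_Ns D))"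

end

theory Submission
  imports Defs
begin

text \<open>Shifting a tube that is feasible at time \<open>t - 1\<close> by one step, and closing it with the terminal
  set and the noise \<open>s\<close>, gives a tube feasible at time \<open>t\<close>: the true parameter is never discarded, so
  the first cross section of the old tube contains the new state, the parameter sets are nested, and
  the terminal set is invariant. On this candidate the PE constraints are the ones
  that define the bounds \<open>\<beta>\<close>, so they hold with equality in the bounds.\<close>

section \<open>Set membership of the true parameter\<close>

lemma parameter_update_mem:
  assumes "parameter_update D R t" and "\<theta> \<in> Theta_at D R (t - 1)"
    and "\<And>j. \<theta> \<in> Delta D R j"
  shows "\<theta> \<in> Theta_at D R t"
proof -
  have "(mat_MTheta D *v \<theta>) $ i \<le> mu R t $ i" for i
    using assms by (auto simp: parameter_update_def Let_def is_maximum_def)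
  then show ?thesis
    by (simp add: Theta_at_def Theta_of_def less_eq_vec_def)
qed

text \<open>At the true parameter the one-step residual is exactly the realized disturbance term
  \<open>F w\<close>.\<close>

lemma closed_loop_Delta:
  assumes "closed_loop D \<theta>s R"
  shows "\<theta>s \<in> Delta D R j"
proof (cases "j \<le> 0")
  case False
  \<comment> \<open>Since \<open>j > 0\<close>, the truncated subtraction is exact, and the index
    takes the form \<open>t + 1\<close> of the plant equation.\<close>
  then have "nat j = nat j - 1 + 1" by simp
  with assms have "state R (nat j) = A_of D \<theta>s *v state R (nat j - 1)
      + B_of D \<theta>s *v input R (nat j - 1) + mat_F D *v dist_w R (nat j - 1)"
    unfolding closed_loop_def by metis
  moreover have "dist_w R (nat j - 1) \<in> set_W D"
    using assms by (simp add: closed_loop_def)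
  ultimately show ?thesis
    using False by (simp add: Delta_def FW_def)
qed (simp add: Delta_def)

lemma closed_loop_parameter_mem:
  assumes "closed_loop D \<theta>s R" and "\<theta>s \<in> Theta_of D (mu_init D)"
  shows "\<theta>s \<in> Theta_at D R t"
proof (induction t)
  case 0
  then show ?case using assms by (simp add: closed_loop_def Theta_at_def)
next
  case (Suc t)
  have "parameter_update D R (Suc t)"
    using assms(1) by (simp add: closed_loop_def)
  then show ?case
    by (rule parameter_update_mem) (use Suc closed_loop_Delta[OF assms(1)] in simp_all)
qed

section \<open>Propagating and shifting tubes\<close>

lemma tube_constraints_next_state:
  assumes "tube_constraints D \<Theta> x v X" and "1 \<le> hor_N D" and "\<theta> \<in> \<Theta>" and "w \<in> set_W D"
  shows "A_of D \<theta> *v x + B_of D \<theta> *v (gain D *v x + v 0) + mat_F D *v w \<in> tube_set (X 1)"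
proof -
  have "AK_of D \<theta> *v x + B_of D \<theta> *v v 0 + mat_F D *v w
      \<in> (\<lambda>y. AK_of D \<theta> *v y) ` tube_set (X 0) + {B_of D \<theta> *v v 0} + FW D"
    using assms by (intro set_plus_intro) (auto simp: tube_constraints_def FW_def)
  also have "\<dots> \<subseteq> tube_set (X (0 + 1))"
    using assms unfolding tube_constraints_def by fastforce
  finally show ?thesis
    by (simp add: AK_of_def matrix_vector_mult_add_rdistrib matrix_vector_right_distrib
        matrix_vector_mul_assoc add.assoc)
qed

text \<open>Below step \<open>N - 1\<close> the new sections inherit the old constraints one step
  later; at step \<open>N - 1\<close> the terminal conditions take over. The new tube is prescribed
  through its sets, not its vertices, so that the fallback tube is covered as well.\<close>

lemma tube_constraints_shift:
  assumes off: "offline_data D" and tube: "tube_constraints D \<Theta> x v X"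
    and sub: "\<Theta>' \<subseteq> \<Theta>" "\<Theta>' \<subseteq> Theta_of D (mu_init D)"
    and x': "x' \<in> tube_set (X 1)"
    and s: "s (hor_N D - 1) \<in> set_S D"
    and v': "\<And>k. k < hor_N D \<Longrightarrow> v' k = ref_v D v s k"
    and cls: "\<And>k. k < hor_N D + hor_Nu D \<Longrightarrow> X' k \<in> tube_class (tubes D)"
    and X': "\<And>k. k < hor_N D + hor_Nu D \<Longrightarrow> tube_set (X' k) =
        (if k = 0 then {x'} else if k + 2 \<le> hor_N D then tube_set (X (k + 1)) else set_XT D)"
  shows "tube_constraints D \<Theta>' x' v' X'"
proof -
  have N: "1 \<le> hor_N D" "1 \<le> hor_Nu D"
    using off by (auto simp: offline_data_def)
  have XN: "tube_set (X (hor_N D)) = set_XT D"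
    using tube N by (simp add: tube_constraints_def)
  have mono_U: "(\<lambda>y. gain D *v y) ` A + C \<subseteq> (\<lambda>y. gain D *v y) ` B + E"
    if "A \<subseteq> B" "C \<subseteq> E" for A B C E
    by (intro set_plus_mono2 image_mono that)
  have mono_X: "(\<lambda>y. AK_of D \<theta> *v y) ` A + C + FW D \<subseteq> (\<lambda>y. AK_of D \<theta> *v y) ` B + E + FW D"
    if "A \<subseteq> B" "C \<subseteq> E" for A B C E \<theta>
    by (intro set_plus_mono2 image_mono that order_refl)
  \<comment> \<open>Only at \<open>k = 0\<close> can the inclusion be strict: there it says that
    \<open>x'\<close> lies in the old section 1.\<close>
  have le: "tube_set (X' k) \<subseteq> tube_set (X (k + 1))" if "k < hor_N D" for k
  proof (cases "k + 1 = hor_N D")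
    case True
    then show ?thesis using X'[of k] that x' XN N by auto
  next
    case False
    then show ?thesis using X'[of k] that x' by auto
  qed
  have "tube_set (X' k) \<subseteq> set_X D \<and>
        (\<lambda>y. gain D *v y) ` tube_set (X' k) + {v' k} \<subseteq> set_U D \<and>
        (\<lambda>y. AK_of D \<theta> *v y) ` tube_set (X' k) + {B_of D \<theta> *v v' k} + FW D \<subseteq> tube_set (X' (k + 1))"
    if \<theta>: "\<theta> \<in> \<Theta>'" and k: "k < hor_N D" for \<theta> k
  proof (cases "k + 1 < hor_N D")
    case True
    have "k < hor_N D - 1" using True by simp
    then have vk: "v' k = v (k + 1)" using v'[OF k] by (simp only: ref_v_def if_True)
    have old: "tube_set (X (k + 1)) \<subseteq> set_X D"
        "(\<lambda>y. gain D *v y) ` tube_set (X (k + 1)) + {v (k + 1)} \<subseteq> set_U D"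
        "(\<lambda>y. AK_of D \<theta> *v y) ` tube_set (X (k + 1)) + {B_of D \<theta> *v v (k + 1)} + FW D
           \<subseteq> tube_set (X (k + 1 + 1))"
      using tube \<theta> sub True unfolding tube_constraints_def by blast+
    \<comment> \<open>The target of the dynamics must not shrink, so an equality is needed here. If
      \<open>N = k + 2\<close>, both sides are the terminal set.\<close>
    have "tube_set (X' (k + 1)) = tube_set (X (k + 1 + 1))"
    proof (cases "k + 3 \<le> hor_N D")
      case False
      with True have "hor_N D = k + 1 + 1" by simp
      then show ?thesis using X'[of "k + 1"] XN N by simp
    qed (use X'[of "k + 1"] in simp)
    then show ?thesis
      unfolding vk using old(1) order_trans[OF mono_U[OF le[OF k] order_refl] old(2)]
        order_trans[OF mono_X[OF le[OF k] order_refl] old(3)] le[OF k] by auto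
  next
    case False
    then have kN: "k = hor_N D - 1" using k by simp
    have vk: "v' k = s (hor_N D - 1)" using v'[OF k] kN by (simp add: ref_v_def)
    \<comment> \<open>An inclusion only, because for \<open>N = 1\<close> this section is
      \<open>{x'}\<close>.\<close>
    have sub_XT: "tube_set (X' k) \<subseteq> set_XT D" using le[OF k] kN N XN by simp
    have XT: "set_XT D \<subseteq> set_X D" "(\<lambda>x. gain D *v x) ` set_XT D + set_S D \<subseteq> set_U D"
        "(\<lambda>x. AK_of D \<theta> *v x) ` set_XT D + (\<lambda>v. B_of D \<theta> *v v) ` set_S D + FW D \<subseteq> set_XT D"
      using off \<theta> sub(2) unfolding offline_data_def by blast+
    have next_XT: "tube_set (X' (k + 1)) = set_XT D"
      using X'[of "k + 1"] kN N by simp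
    have "{v' k} \<subseteq> set_S D" "{B_of D \<theta> *v v' k} \<subseteq> (\<lambda>v. B_of D \<theta> *v v) ` set_S D"
      using s vk by auto
    then show ?thesis
      unfolding next_XT using XT(1) sub_XT order_trans[OF mono_U[OF sub_XT] XT(2)]
        order_trans[OF mono_X[OF sub_XT] XT(3)] by auto
  qed
  moreover have "tube_set (X' 0) = {x'}" using X'[of 0] N by simp
  moreover have "tube_set (X' k) = set_XT D" if "k \<in> {hor_N D..hor_N D + hor_Nu D - 1}" for k
    using X'[of k] that N by auto
  ultimately show ?thesis
    using cls unfolding tube_constraints_def by blast
qed

text \<open>The last section lies beyond every PE window; this permits replacing it in the shifted
  tube.\<close>

lemma pe_constraints_cong_tube:
  assumes "\<And>k. k + 1 < hor_N D + hor_Nu D \<Longrightarrow> X k = X' k"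
  shows "pe_constraints D t past xh uh q X \<beta> M \<longleftrightarrow> pe_constraints D t past xh uh q X' \<beta> M"
  using assms unfolding pe_constraints_def by simp

section \<open>Recursive feasibility along one realization\<close>

locale nested_closed_loop =
  fixes D :: "('nx::finite, 'nu::finite, 'nw::finite, 'p::finite, 'm::finite, 'v::finite, 'r::finite)
                mpc_data"
    and \<theta>s :: "real^'p"
    and R :: "('nx, 'nu, 'nw, 'p, 'm, 'v) mpc_run"
  assumes off: "offline_data D" and true_parameter: "\<theta>s \<in> Theta_of D (mu_init D)"
    and loop: "closed_loop D \<theta>s R"
    and nested: "\<And>t. Theta_at D R (Suc t) \<subseteq> Theta_at D R t"
begin

lemma horizons: "1 \<le> hor_N D" "1 \<le> hor_Nu D"
  using off by (auto simp: offline_data_def)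

lemma Theta_at_subset_init: "Theta_at D R t \<subseteq> Theta_of D (mu_init D)"
proof (induction t)
  case 0
  then show ?case using loop by (simp add: closed_loop_def Theta_at_def)
qed (use nested in blast)

text \<open>The input law is a hypothesis because the closed loop imposes it only at feasible times.\<close>

lemma tube_constraints_successor:
  assumes tube: "tube_constraints D (Theta_at D R t) (state R t) (v_sol R t) (X_sol R t)"
    and inp: "input R t = gain D *v state R t + v_sol R t 0"
    and v: "\<And>k. k < hor_N D \<Longrightarrow> v k = v_hat D R (Suc t) k"
    and cls: "\<And>k. k < hor_N D + hor_Nu D \<Longrightarrow> X k \<in> tube_class (tubes D)"
    and X: "\<And>k. k < hor_N D + hor_Nu D \<Longrightarrow> tube_set (X k) =
        (if k = 0 then {state R (Suc t)} else if k + 2 \<le> hor_N D then tube_set (X_sol R t (k + 1))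
         else set_XT D)"
  shows "tube_constraints D (Theta_at D R (Suc t)) (state R (Suc t)) v X"
proof (rule tube_constraints_shift[OF off tube nested Theta_at_subset_init _ _ _ cls X])
  have "state R (Suc t) = A_of D \<theta>s *v state R t + B_of D \<theta>s *v input R t + mat_F D *v dist_w R t"
    and "dist_w R t \<in> set_W D"
    using loop by (simp_all add: closed_loop_def)
  then show "state R (Suc t) \<in> tube_set (X_sol R t 1)"
    using tube_constraints_next_state[OF tube horizons(1)
        closed_loop_parameter_mem[OF loop true_parameter]] inp by simp
  show "noise R (Suc t) (hor_N D - 1) \<in> set_S D"
    using loop horizons by (simp add: closed_loop_def)
qed (use v in \<open>simp_all add: v_hat_def\<close>)

text \<open>The witness consists of \<open>v_hat\<close>, the shifted tube, \<open>beta_hat\<close>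
  itself and the matrices \<open>M\<close> that realize \<open>beta_hat\<close>.\<close>

lemma feasible_successor:
  assumes tube: "tube_constraints D (Theta_at D R t) (state R t) (v_sol R t) (X_sol R t)"
    and inp: "input R t = gain D *v state R t + v_sol R t 0"
  shows "P_pos_feasible D R (Suc t)"
proof -
  obtain f where f: "f \<in> tube_class (tubes D)" "tube_set f = set_XT D"
    using off unfolding offline_data_def by blast
  \<comment> \<open>At its last index \<open>X_shift\<close> would read the old tube one step past
    its horizon, where it is unconstrained; \<open>f\<close> represents the terminal set
    instead.\<close>
  define X where "X = (X_shift R (Suc t))(hor_N D + hor_Nu D - 1 := f)"
  have last: "hor_N D + hor_Nu D - 1 \<noteq> 0" using horizons by simp
  have shift: "X k = (if k = 0 then (\<lambda>_. state R (Suc t)) else X_sol R t (k + 1))"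
    if "k + 1 < hor_N D + hor_Nu D" for k
    using that by (auto simp: X_def X_shift_def)
  have cls_old: "X_sol R t k \<in> tube_class (tubes D)" if "k < hor_N D + hor_Nu D" for k
    using tube that by (simp add: tube_constraints_def)
  have XT_old: "tube_set (X_sol R t k) = set_XT D" if "hor_N D \<le> k" "k < hor_N D + hor_Nu D" for k
    using tube that by (auto simp: tube_constraints_def)
  have "tube_constraints D (Theta_at D R (Suc t)) (state R (Suc t)) (v_hat D R (Suc t)) X"
  proof (rule tube_constraints_successor[OF tube inp])
    fix k assume k: "k < hor_N D + hor_Nu D"
    show "X k \<in> tube_class (tubes D)"
    proof (cases "k + 1 < hor_N D + hor_Nu D")
      case True
      then show ?thesis using shift cls_old[of "k + 1"] off by (auto simp: offline_data_def)
    next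
      case False
      with k have "k = hor_N D + hor_Nu D - 1" by simp
      then show ?thesis using f by (simp add: X_def)
    qed
    show "tube_set (X k) =
        (if k = 0 then {state R (Suc t)} else if k + 2 \<le> hor_N D then tube_set (X_sol R t (k + 1))
         else set_XT D)"
    proof (cases "k + 1 < hor_N D + hor_Nu D")
      case True
      \<comment> \<open>If \<open>k + 2 \<le> N\<close> fails, then \<open>k + 1 \<ge> N\<close>, so
        the old section is already terminal.\<close>
      then show ?thesis using shift XT_old[of "k + 1"] by (auto simp: tube_set_def)
    next
      case False
      with k have "k = hor_N D + hor_Nu D - 1" by simp
      then show ?thesis using f last horizons by (simp add: X_def)
    qed
  qed simp
  moreover have "reference_update D R (Suc t)"
    using loop by (simp add: closed_loop_def)
  then obtain M where "pe_constraints D (Suc t) (past_term D R (Suc t)) (x_hat D R (Suc t))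
      (u_hat D R (Suc t)) (pert D (v_hat D R (Suc t)) (noise R (Suc t))) (X_shift R (Suc t))
      (beta_hat R (Suc t)) M"
    unfolding reference_update_def max_pe_coeffs_def by blast
  then have "pe_constraints D (Suc t) (past_term D R (Suc t)) (x_hat D R (Suc t))
      (u_hat D R (Suc t)) (pert D (v_hat D R (Suc t)) (noise R (Suc t))) X (beta_hat R (Suc t)) M"
    by (subst pe_constraints_cong_tube[where X' = "X_shift R (Suc t)"]) (auto simp: X_def)
  ultimately show ?thesis
    unfolding P_pos_feasible_def P_pos_constraints_def by blast
qed

text \<open>Both conjuncts at \<open>t\<close> yield feasibility at \<open>t + 1\<close>, and the
  algorithm imposes the solution and the input law only at feasible times; hence the joint
  induction.\<close>

lemma selected_solution_admissible:
  "tube_constraints D (Theta_at D R t) (state R t) (v_sol R t) (X_sol R t) \<and>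
   input R t = gain D *v state R t + v_sol R t 0"
proof (induction t)
  case 0
  then show ?case
    using loop by (auto simp: closed_loop_def P_zero_solution_def is_arg_min_def)
next
  case (Suc t)
  have "P_pos_feasible D R (Suc t)"
    using Suc feasible_successor by blast
  then have sol: "P_pos_solution D R (Suc t) (v_opt R (Suc t)) (X_opt R (Suc t))"
    and sel: "select_solution D R (Suc t)"
    and inp: "input R (Suc t) = gain D *v state R (Suc t) + v_sol R (Suc t) 0"
    using loop by (simp_all add: closed_loop_def)
  have "tube_constraints D (Theta_at D R (Suc t)) (state R (Suc t)) (v_sol R (Suc t)) (X_sol R (Suc t))"
  \<comment> \<open>If \<open>fallback\<close> fails, the sampling test cannot have triggered, so
    the optimizer was kept.\<close>
  proof (cases "fallback D R (Suc t)")
    case True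
    with Suc show ?thesis
      by (intro tube_constraints_successor) (auto simp: fallback_def)
  next
    case False
    then have "v_sol R (Suc t) = v_opt R (Suc t)" "X_sol R (Suc t) = X_opt R (Suc t)"
      using sel by (auto simp: select_solution_def split: if_splits)
    then show ?thesis
      using sol by (auto simp: P_pos_solution_def is_arg_min_def P_pos_constraints_def)
  qed
  with inp show ?case by simp
qed

end

theorem proposition7:
  fixes D :: "('nx::finite, 'nu::finite, 'nw::finite, 'p::finite, 'm::finite, 'v::finite, 'r::finite)
                mpc_data"
    and \<theta>s :: "real^'p"
    and \<Omega> :: "'w measure"
    and R :: "'w \<Rightarrow> ('nx, 'nu, 'nw, 'p, 'm, 'v) mpc_run"
    and \<omega> :: 'w
  assumes "offline_data D"
    and "\<theta>s \<in> Theta_of D (mu_init D)"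
    and "noise_model D \<Omega> R"
    and "sampling_model D \<Omega> R"
    and "\<forall>\<omega>\<in>space \<Omega>. closed_loop D \<theta>s (R \<omega>)"
    and "\<omega> \<in> space \<Omega>"
    and "P_pos_feasible D (R \<omega>) 1"
    and "\<forall>t\<ge>1. Theta_at D (R \<omega>) t \<subseteq> Theta_at D (R \<omega>) (t - 1)"
  shows "\<forall>t\<ge>1. P_pos_feasible D (R \<omega>) t"
proof (intro allI impI)
  fix t :: nat
  assume "1 \<le> t"
  then obtain n where t: "t = Suc n" by (cases t) auto
  have "Theta_at D (R \<omega>) (Suc t) \<subseteq> Theta_at D (R \<omega>) t" for t
    using assms(8)[rule_format, of "Suc t"] by simp
  \<comment> \<open>The claim is pathwise: for fixed \<open>\<omega>\<close> the closed loop is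
    deterministic.\<close>
  then interpret nested_closed_loop D \<theta>s "R \<omega>"
    using assms by unfold_locales auto
  show "P_pos_feasible D (R \<omega>) t"
    using selected_solution_admissible feasible_successor unfolding t by blast
qed

end
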